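(* Let $\mathcal{E}=\{\eta_i,\rho_i\}_{i=0}^{n-1}$ be a bipartite quantum state ensemble on $\mathcal{H}=\mathbb{C}^{d_{\rm A}}\otimes\mathbb{C}^{d_{\rm B}}$ and let $L$ be any positive integer. Then $$q_{\rm G}(\mathcal{E}^{(L)})\leqslant\frac1n+\frac{n-1}{n}\big[n\,q_{\rm G}(\mathcal{E})-1\big]^{L}.$$
   Context: Let $\mathcal{H}=\mathbb{C}^{d_{\rm A}}\otimes\mathbb{C}^{d_{\rm B}}$ be a finite-dimensional bipartite Hilbert space, the first factor held by Alice and the second by Bob. A state is a density operator $\rho\succeq 0$, $\operatorname{Tr}\rho=1$. A bipartite quantum state ensemble $\mathcal{E}=\{\eta_i,\rho_i\}_{i=0}^{n-1}$ consists of states $\rho_i$ and prior probabilities $\eta_i\in[0,1]$ with $\sum_i\eta_i=1$. A measurement $\mathcal{M}=\{M_i\}_{i=0}^{n-1}$ is a family of positive-semidefinite operators with $\sum_i M_i=I$. The superscript $\mathrm{PT}$ denotes partial transposition: transposition, in a fixed orthonormal product basis, of one fixed party's subsystem. Define $$q_{\rm G}(\mathcal{E})=\max_{\mathcal{M}}\sum_{i=0}^{n-1}\eta_i\operatorname{Tr}(\rho_i^{\mathrm{PT}}M_i),$$ the maximum being over all measurements. For $\mathcal{E}=\{\eta_i,\rho_i\}_{i=0}^{n-1}$, a positive integer $L$, and $\vec c=(c_1,\dots,c_L)\in\mathbb{Z}_n^L$ with $\mathbb{Z}_n=\{0,\dots,n-1\}$, put $\eta_{\vec c}=\prod_{l=1}^L\eta_{c_l}$,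 $\rho_{\vec c}=\bigotimes_{l=1}^L\rho_{c_l}$, and $\omega_n(\vec c)=\sum_{l=1}^L c_l \pmod n\in\mathbb{Z}_n$. Define $$\eta_i^{(L)}=\sum_{\vec c\in\mathbb{Z}_n^L,\ \omega_n(\vec c)=i}\eta_{\vec c},\qquad \rho_i^{(L)}=\frac{1}{\eta_i^{(L)}}\sum_{\vec c\in\mathbb{Z}_n^L,\ \omega_n(\vec c)=i}\eta_{\vec c}\,\rho_{\vec c},\qquad \mathcal{E}^{(L)}=\{\eta_i^{(L)},\rho_i^{(L)}\}_{i=0}^{n-1}$$ (if $\eta_i^{(L)}=0$, $\rho_i^{(L)}$ is an arbitrary state). $\mathcal{E}^{(L)}$ is regarded as a bipartite ensemble on $\mathcal{H}^{\otimes L}\cong(\mathbb{C}^{d_{\rm A}})^{\otimes L}\otimes(\mathbb{C}^{d_{\rm B}})^{\otimes L}$, Alice holding all $L$ copies of $\mathbb{C}^{d_{\rm A}}$ and Bob all $L$ copies of $\mathbb{C}^{d_{\rm B}}$; partial transposition for $\mathcal{E}^{(L)}$ is with respect to this bipartition, so that $(\bigotimes_l\rho_{c_l})^{\mathrm{PT}}=\bigotimes_l\rho_{c_l}^{\mathrm{PT}}$. *)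

theory Defs
  imports "HOL-Analysis.Analysis"
begin

definition psd :: "complex^'d^'d \<Rightarrow> bool" where
  "psd A \<longleftrightarrow> (\<forall>i j. A $ i $ j = cnj (A $ j $ i)) \<and>
     (\<forall>x. 0 \<le> Re (\<Sum>i\<in>UNIV. cnj (x $ i) * (A *v x) $ i))"

definition density_operator :: "complex^'d^'d \<Rightarrow> bool" where
  "density_operator A \<longleftrightarrow> psd A \<and> trace A = 1"

definition ensemble :: "nat \<Rightarrow> (nat \<Rightarrow> real) \<Rightarrow> (nat \<Rightarrow> complex^'d^'d) \<Rightarrow> bool" where
  "ensemble n \<eta> \<rho> \<longleftrightarrow>
     (\<forall>i<n. density_operator (\<rho> i)) \<and> (\<forall>i<n. \<eta> i \<in> {0..1}) \<and> (\<Sum>i<n. \<eta> i) = 1"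

definition measurement :: "nat \<Rightarrow> (nat \<Rightarrow> complex^'d^'d) \<Rightarrow> bool" where
  "measurement n M \<longleftrightarrow> (\<forall>i<n. psd (M i)) \<and> (\<Sum>i<n. M i) = mat 1"

text \<open>
  The bipartite space is \<open>complex ^ ('a \<times> 'b)\<close>, with \<open>'a\<close> and \<open>'b\<close> indexing the bases of
  Alice and Bob.  The transposed party is Bob; since \<open>'a\<close> and \<open>'b\<close> are arbitrary, this is no
  restriction.
\<close>

definition partial_transpose ::
    "complex^('a::finite \<times> 'b::finite)^('a \<times> 'b) \<Rightarrow> complex^('a \<times> 'b)^('a \<times> 'b)" where
  "partial_transpose A = (\<chi> p q. A $ (fst p, snd q) $ (fst q, snd p))"

definition pt_success ::
    "nat \<Rightarrow> (nat \<Rightarrow> real) \<Rightarrow> (nat \<Rightarrow> complex^('a::finite \<times> 'b::finite)^('a \<times> 'b))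
      \<Rightarrow> (nat \<Rightarrow> complex^('a \<times> 'b)^('a \<times> 'b)) \<Rightarrow> real" where
  "pt_success n \<eta> \<rho> M = (\<Sum>i<n. \<eta> i * Re (trace (partial_transpose (\<rho> i) ** M i)))"

text \<open>The supremum is a maximum for every \<open>n > 0\<close>; see \<open>q_G_is_max\<close> below.\<close>

definition q_G ::
    "nat \<Rightarrow> (nat \<Rightarrow> real) \<Rightarrow> (nat \<Rightarrow> complex^('a::finite \<times> 'b::finite)^('a \<times> 'b)) \<Rightarrow> real" where
  "q_G n \<eta> \<rho> = (SUP M \<in> {M. measurement n M}. pt_success n \<eta> \<rho> M)"

text \<open>
  The \<open>L\<close> copies are indexed by a finite type \<open>'l\<close> with \<open>CARD('l) = L\<close>.  Alice's \<open>L\<close>-fold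
  tensor power then has the basis \<open>'l \<Rightarrow> 'a\<close> and Bob's the basis \<open>'l \<Rightarrow> 'b\<close>, so that
  \<open>complex ^ (('l \<Rightarrow> 'a) \<times> ('l \<Rightarrow> 'b))\<close> carries the regrouped bipartition and
  \<open>partial_transpose\<close> at this type transposes all of Bob's copies.
\<close>

definition tensor_copies ::
    "('l::finite \<Rightarrow> complex^('a::finite \<times> 'b::finite)^('a \<times> 'b))
      \<Rightarrow> complex^(('l \<Rightarrow> 'a) \<times> ('l \<Rightarrow> 'b))^(('l \<Rightarrow> 'a) \<times> ('l \<Rightarrow> 'b))" where
  "tensor_copies R = (\<chi> p q. \<Prod>l\<in>UNIV. R l $ (fst p l, snd p l) $ (fst q l, snd q l))"

definition strings :: "nat \<Rightarrow> nat \<Rightarrow> ('l::finite \<Rightarrow> nat) set" where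
  "strings n i = {c. (\<forall>l. c l < n) \<and> (\<Sum>l\<in>UNIV. c l) mod n = i}"

definition multi_prior :: "'l::finite itself \<Rightarrow> nat \<Rightarrow> (nat \<Rightarrow> real) \<Rightarrow> nat \<Rightarrow> real" where
  "multi_prior _ n \<eta> i = (\<Sum>c \<in> (strings n i :: ('l \<Rightarrow> nat) set). \<Prod>l\<in>UNIV. \<eta> (c l))"

text \<open>The family \<open>\<sigma>\<close> supplies the states attached to outcomes of prior probability zero.\<close>

definition multi_state ::
    "nat \<Rightarrow> (nat \<Rightarrow> real) \<Rightarrow> (nat \<Rightarrow> complex^('a::finite \<times> 'b::finite)^('a \<times> 'b))
      \<Rightarrow> (nat \<Rightarrow> complex^(('l::finite \<Rightarrow> 'a) \<times> ('l \<Rightarrow> 'b))^(('l \<Rightarrow> 'a) \<times> ('l \<Rightarrow> 'b)))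
      \<Rightarrow> nat \<Rightarrow> complex^(('l \<Rightarrow> 'a) \<times> ('l \<Rightarrow> 'b))^(('l \<Rightarrow> 'a) \<times> ('l \<Rightarrow> 'b))" where
  "multi_state n \<eta> \<rho> \<sigma> i =
     (if multi_prior TYPE('l) n \<eta> i = 0 then \<sigma> i
      else (1 / multi_prior TYPE('l) n \<eta> i) *\<^sub>R
        (\<Sum>c \<in> strings n i. (\<Prod>l\<in>UNIV. \<eta> (c l)) *\<^sub>R tensor_copies (\<lambda>l. \<rho> (c l))))"

lemma partial_transpose_tensor_copies:
  "partial_transpose (tensor_copies R) = tensor_copies (\<lambda>l. partial_transpose (R l))"
  by (simp add: partial_transpose_def tensor_copies_def vec_eq_iff)

lemma sum_axis: "(\<Sum>i\<in>UNIV. cnj (axis j v $ i) * f i) = cnj v * f (j::'d::finite)"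
proof -
  have "cnj (axis j v $ i) * f i = (if i = j then cnj v * f i else 0)" for i
    by (auto simp: axis_def)
  then show ?thesis by simp
qed

lemma mult_axis: "(A *v axis k v) $ i = A $ i $ (k::'d::finite) * (v::complex)"
proof -
  have "A $ i $ j * axis k v $ j = (if j = k then A $ i $ j * v else 0)" for j
    by (auto simp: axis_def)
  then show ?thesis by (simp add: matrix_vector_mult_def)
qed

lemma psd_diag:
  assumes "psd A"
  shows "0 \<le> Re (A $ j $ j)" "Im (A $ j $ j) = 0"
proof -
  have e: "(\<Sum>i\<in>UNIV. cnj (axis j 1 $ i) * (A *v axis j 1) $ i) = A $ j $ j"
    by (simp add: sum_axis mult_axis)
  show "0 \<le> Re (A $ j $ j)" using assms e unfolding psd_def by metis
  have "A $ j $ j = cnj (A $ j $ j)" using assms unfolding psd_def by blast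
  then show "Im (A $ j $ j) = 0" by (simp add: complex_eq_iff)
qed

lemma psd_entry_bound:
  assumes "psd A"
  shows "2 * norm (A $ j $ k) \<le> Re (A $ j $ j) + Re (A $ k $ k)"
proof (cases "j = k \<or> A $ j $ k = 0")
  case True
  then show ?thesis using psd_diag[OF assms, of j] psd_diag[OF assms, of k]
    by (auto simp: cmod_def)
next
  case False
  define r where "r = A $ j $ k"
  define u where "u = cnj r / of_real (norm r)"
  have r: "r \<noteq> 0" using False r_def by simp
  have jk: "j \<noteq> k" using False by simp
  have h: "A $ k $ j = cnj r" using assms unfolding psd_def r_def by blast
  define x where "x = axis j 1 - axis k u"
  have Ax: "(A *v x) $ i = A $ i $ j - A $ i $ k * u" for i
    by (simp add: x_def matrix_vector_mult_diff_distrib mult_axis)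
  have "(\<Sum>i\<in>UNIV. cnj (x $ i) * (A *v x) $ i)
      = (A *v x) $ j - cnj u * (A *v x) $ k"
    by (simp add: x_def left_diff_distrib sum_subtractf sum_axis)
  also have "\<dots> = A $ j $ j - r * u - cnj u * cnj r + cnj u * u * A $ k $ k"
    by (simp add: Ax h r_def[symmetric] algebra_simps)
  also have "r * u = of_real (norm r)"
    using r by (simp add: u_def complex_norm_square[symmetric] power2_eq_square)
  also have "cnj u * cnj r = of_real (norm r)"
    using r by (simp add: u_def complex_norm_square[symmetric] power2_eq_square mult.commute)
  also have "cnj u * u = 1"
    using r by (simp add: u_def complex_norm_square[symmetric] power2_eq_square)
  finally have "(\<Sum>i\<in>UNIV. cnj (x $ i) * (A *v x) $ i)
      = A $ j $ j - 2 * of_real (norm r) + A $ k $ k" by simp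
  moreover have "0 \<le> Re (\<Sum>i\<in>UNIV. cnj (x $ i) * (A *v x) $ i)"
    using assms unfolding psd_def by blast
  ultimately show ?thesis by (simp add: r_def)
qed

lemma measurement_entry_bound:
  assumes "measurement n M" "i < n"
  shows "norm (M i $ j $ k) \<le> 1"
proof -
  have d: "Re (M i $ j $ j) \<le> 1" for j
  proof -
    have "(\<Sum>i<n. M i) $ j $ j = 1"
      using assms unfolding measurement_def by (simp add: mat_def)
    then have "(\<Sum>i<n. Re (M i $ j $ j)) = 1"
      by (simp add: sum_component flip: Re_sum)
    moreover have "Re (M i $ j $ j) \<le> (\<Sum>i<n. Re (M i $ j $ j))"
      using assms by (intro member_le_sum) (auto simp: measurement_def psd_diag)
    ultimately show ?thesis by simp
  qed
  have "psd (M i)" using assms unfolding measurement_def by auto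
  from psd_entry_bound[OF this, of j k] d[of j] d[of k] show ?thesis by simp
qed

lemma measurement_norm_bound:
  fixes M :: "nat \<Rightarrow> complex^'d^'d"
  assumes "measurement n M" "i < n"
  shows "norm (M i) \<le> CARD('d) * CARD('d)"
proof -
  have "norm (M i) \<le> (\<Sum>j\<in>UNIV. norm (M i $ j))"
    by (simp add: norm_vec_def L2_set_le_sum)
  also have "\<dots> \<le> (\<Sum>j\<in>(UNIV::'d set). \<Sum>k\<in>(UNIV::'d set). norm (M i $ j $ k))"
    by (intro sum_mono) (simp add: norm_vec_def L2_set_le_sum)
  also have "\<dots> \<le> (\<Sum>j\<in>(UNIV::'d set). \<Sum>k\<in>(UNIV::'d set). 1)"
    by (intro sum_mono measurement_entry_bound[OF assms])
  finally show ?thesis by simp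
qed

lemma closed_psd: "closed {A. psd A}"
proof -
  have "{A. psd A} = (\<Inter>i. \<Inter>j. {A. A $ i $ j = cnj (A $ j $ i)}) \<inter>
     (\<Inter>x. {A. 0 \<le> Re (\<Sum>i\<in>UNIV. cnj (x $ i) * (A *v x) $ i)})"
    by (auto simp: psd_def)
  also have "closed \<dots>"
    unfolding matrix_vector_mult_def
    by (intro closed_Int closed_INT ballI closed_Collect_eq closed_Collect_le)
      (auto intro!: continuous_intros)
  finally show ?thesis .
qed

lemma measurement_exists:
  assumes "n > 0"
  shows "\<exists>M. measurement n (M :: nat \<Rightarrow> complex^'d^'d)"
proof -
  have 1: "psd (mat 1 :: complex^'d^'d)"
    by (auto simp: psd_def mat_def[abs_def] matrix_vector_mult_def if_distrib if_distribR
        intro!: sum_nonneg cong: if_cong)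
  have 0: "psd (0 :: complex^'d^'d)"
    by (auto simp: psd_def matrix_vector_mult_def)
  show ?thesis
    by (rule exI[of _ "\<lambda>i. if i = 0 then mat 1 else 0"])
      (use assms 0 1 in \<open>auto simp: measurement_def sum.delta\<close>)
qed

lemma q_G_is_max:
  fixes \<rho> :: "nat \<Rightarrow> complex^('a::finite \<times> 'b::finite)^('a \<times> 'b)"
  assumes "n > 0"
  shows "\<exists>M. measurement n M \<and> q_G n \<eta> \<rho> = pt_success n \<eta> \<rho> M"
    and "measurement n M \<Longrightarrow> pt_success n \<eta> \<rho> M \<le> q_G n \<eta> \<rho>"
proof -
  define B where "B = real (CARD('a \<times> 'b) * CARD('a \<times> 'b))"
  define K where "K = Pi\<^sub>E UNIV (\<lambda>i. if i < n
      then cball (0 :: complex^('a \<times> 'b)^('a \<times> 'b)) B else {0})"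
  define C where "C = K \<inter> {M. measurement n M}"
  have "compactin (product_topology (\<lambda>i::nat. euclidean) UNIV) K"
    unfolding K_def by (subst compactin_PiE) auto
  then have K: "compact K" by (simp add: euclidean_product_topology)
  have "{M :: nat \<Rightarrow> complex^('a \<times> 'b)^('a \<times> 'b). measurement n M} =
     (\<Inter>i\<in>{..<n}. (\<lambda>M. M i) -` {A. psd A}) \<inter> {M. (\<Sum>i<n. M i) = mat 1}"
    by (auto simp: measurement_def)
  also have "closed \<dots>"
    by (intro closed_Int closed_INT ballI closed_Collect_eq closed_vimage closed_psd
        continuous_on_sum continuous_on_product_coordinates continuous_on_const)
  finally have C: "compact C" unfolding C_def using K by (intro compact_Int_closed) auto
  have cont: "continuous_on C (pt_success n \<eta> \<rho>)"
    unfolding pt_success_def[abs_def] trace_def matrix_matrix_mult_def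
    by (auto intro!: continuous_intros continuous_on_subset[OF continuous_on_product_coordinates])
  have red: "\<exists>M'\<in>C. pt_success n \<eta> \<rho> M' = pt_success n \<eta> \<rho> M" if "measurement n M" for M
  proof
    let ?M = "\<lambda>i. if i < n then M i else 0"
    show "pt_success n \<eta> \<rho> ?M = pt_success n \<eta> \<rho> M" by (simp add: pt_success_def)
    show "?M \<in> C" using that measurement_norm_bound[OF that]
      by (auto simp: C_def K_def B_def measurement_def)
  qed
  obtain M0 where "measurement n (M0 :: nat \<Rightarrow> complex^('a \<times> 'b)^('a \<times> 'b))"
    using measurement_exists assms by blast
  with red have "C \<noteq> {}" by blast
  from continuous_attains_sup[OF C this cont] obtain M1
    where M1: "M1 \<in> C" "\<And>M. M \<in> C \<Longrightarrow> pt_success n \<eta> \<rho> M \<le> pt_success n \<eta> \<rho> M1" by blast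
  have le: "pt_success n \<eta> \<rho> M \<le> pt_success n \<eta> \<rho> M1" if "measurement n M" for M
    using red[OF that] M1(2) by metis
  have m1: "measurement n M1" using M1 by (simp add: C_def)
  have eq: "q_G n \<eta> \<rho> = pt_success n \<eta> \<rho> M1"
    unfolding q_G_def by (rule cSup_eq_maximum) (use m1 le in auto)
  show "\<exists>M. measurement n M \<and> q_G n \<eta> \<rho> = pt_success n \<eta> \<rho> M" using m1 eq by blast
  show "measurement n M \<Longrightarrow> pt_success n \<eta> \<rho> M \<le> q_G n \<eta> \<rho>" using le eq by simp
qed

end

theory Submission
  imports Defs
begin

text \<open>
  Put \<open>A j = \<eta> j *\<^sub>R partial_transpose (\<rho> j)\<close>. An optimal measurement yields a
  dual operator \<open>K\<close> with \<open>trace K = q_G\<close> and every \<open>B j = K - A j\<close> positive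
  semidefinite. Write \<open>S\<close> and \<open>B\<close> for the sums of the \<open>A j\<close> and the
  \<open>B j\<close>, so \<open>B = n K - S\<close> has trace \<open>n q_G - 1\<close>. Then
  \<open>1/n S\<^sup>\<otimes>\<^sup>L + (n-1)/n B\<^sup>\<otimes>\<^sup>L\<close>
  has the claimed bound as its trace and is dual feasible for the \<open>L\<close>-fold ensemble: a discrete
  Fourier transform over the residues modulo \<open>n\<close> shows that \<open>n\<close> times the
  operator of outcome \<open>i\<close> is \<open>S\<^sup>\<otimes>\<^sup>L\<close> plus
  \<open>(-1)^L (n F i - B\<^sup>\<otimes>\<^sup>L)\<close>, where \<open>F i\<close> collects the products
  of the \<open>B j\<close> over the strings with sum \<open>i\<close> and lies between \<open>0\<close> and
  \<open>B\<^sup>\<otimes>\<^sup>L\<close>.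
\<close>

section \<open>Positive semidefinite matrices\<close>

definition qform :: "complex^'d^'d \<Rightarrow> complex^'d \<Rightarrow> complex" where
  "qform A x = (\<Sum>i\<in>UNIV. \<Sum>j\<in>UNIV. cnj (x $ i) * A $ i $ j * x $ j)"

definition hermitian :: "complex^'d^'d \<Rightarrow> bool" where
  "hermitian A \<longleftrightarrow> (\<forall>i j. cnj (A $ i $ j) = A $ j $ i)"

definition outer :: "complex^'d \<Rightarrow> complex^'d^'d" where
  "outer v = (\<chi> i j. v $ i * cnj (v $ j))"

lemma psd_iff: "psd A \<longleftrightarrow> hermitian A \<and> (\<forall>x. 0 \<le> Re (qform A x))"
proof -
  have "(\<forall>i j. A $ i $ j = cnj (A $ j $ i)) \<longleftrightarrow> hermitian A"
    unfolding hermitian_def by metis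
  then show ?thesis
    by (simp add: psd_def qform_def matrix_vector_mult_def sum_distrib_left mult.assoc)
qed

lemma qform_add: "qform (A + B) x = qform A x + qform B x"
  by (simp add: qform_def algebra_simps sum.distrib)

lemma qform_diff: "qform (A - B) x = qform A x - qform B x"
  by (simp add: qform_def algebra_simps sum_subtractf)

lemma qform_zero: "qform 0 x = 0"
  by (simp add: qform_def)

lemma qform_sum: "qform (\<Sum>k\<in>S. A k) x = (\<Sum>k\<in>S. qform (A k) x)"
  by (induction S rule: infinite_finite_induct) (simp_all add: qform_zero qform_add)

lemma qform_scaleR: "qform (r *\<^sub>R A) x = r *\<^sub>R qform A x"
  by (simp add: qform_def scaleR_sum_right)

lemma qform_outer: "qform (outer v) x = of_real ((norm (\<Sum>i\<in>UNIV. cnj (v $ i) * x $ i))\<^sup>2)"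
proof -
  have "qform (outer v) x = cnj (\<Sum>i\<in>UNIV. cnj (v $ i) * x $ i) * (\<Sum>i\<in>UNIV. cnj (v $ i) * x $ i)"
    by (simp add: qform_def outer_def sum_product algebra_simps)
  then show ?thesis by (simp add: complex_norm_square mult.commute del: of_real_power)
qed

lemma hermitian_outer: "hermitian (outer v)"
  by (simp add: hermitian_def outer_def)

lemma psd_outer: "psd (outer v)"
  by (simp add: psd_iff hermitian_outer qform_outer del: of_real_power)

lemma psd_zero: "psd 0"
  by (simp add: psd_iff qform_zero hermitian_def)

lemma psd_add: "psd A \<Longrightarrow> psd B \<Longrightarrow> psd (A + B)"
  by (simp add: psd_iff qform_add hermitian_def)

lemma psd_sum: "(\<And>k. k \<in> S \<Longrightarrow> psd (A k)) \<Longrightarrow> psd (\<Sum>k\<in>S. A k)"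
  by (induction S rule: infinite_finite_induct) (simp_all add: psd_zero psd_add)

lemma psd_scaleR: "0 \<le> r \<Longrightarrow> psd A \<Longrightarrow> psd (r *\<^sub>R A)"
  by (auto simp add: psd_iff qform_scaleR hermitian_def)

lemma trace_mult_outer: "trace (A ** outer v) = qform A v"
  by (simp add: trace_def matrix_matrix_mult_def outer_def qform_def sum_distrib_left mult_ac)

lemma matrix_mult_sum_right: "A ** (\<Sum>k\<in>S. B k) = (\<Sum>k\<in>S. A ** (B k :: complex^'d^'d))"
  by (induction S rule: infinite_finite_induct)
    (simp_all add: matrix_add_ldistrib)

lemma matrix_mult_sum_left: "(\<Sum>k\<in>S. B k) ** A = (\<Sum>k\<in>S. (B k :: complex^'d^'d) ** A)"
  by (induction S rule: infinite_finite_induct)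
    (simp_all add: matrix_matrix_mult_def vec_eq_iff algebra_simps sum.distrib)

lemma trace_zero: "trace (0 :: complex^'d^'d) = 0"
  by (simp add: trace_def)

lemma trace_sum: "trace (\<Sum>k\<in>S. A k) = (\<Sum>k\<in>S. trace (A k :: complex^'d^'d))"
  by (induction S rule: infinite_finite_induct) (simp_all add: trace_add trace_zero)

lemma trace_scaleR: "trace (r *\<^sub>R A) = r *\<^sub>R trace (A :: complex^'d^'d)"
  by (simp add: trace_def scaleR_sum_right)

lemma scaleR_matrix_mult:
  fixes A B :: "complex^'d^'d"
  shows "(r *\<^sub>R A) ** B = r *\<^sub>R (A ** B)" "A ** (r *\<^sub>R B) = r *\<^sub>R (A ** B)"
  by (simp_all add: matrix_matrix_mult_def vec_eq_iff scaleR_sum_right)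

lemma matrix_mult_diff:
  fixes A B C :: "complex^'d^'d"
  shows "(A - B) ** C = A ** C - B ** C" "C ** (A - B) = C ** A - C ** B"
  by (simp_all add: matrix_matrix_mult_def vec_eq_iff algebra_simps sum_subtractf)

text \<open>Symmetric Gaussian elimination: subtracting \<open>outer v\<close> for a suitable multiple \<open>v\<close> of
  column \<open>j\<close> clears row and column \<open>j\<close> and leaves the Schur complement.\<close>

lemma psd_gram:
  assumes "psd (A :: complex^'d^'d)"
  shows "\<exists>m v. A = (\<Sum>k<(m::nat). outer (v k))"
  using assms
\<comment> \<open>The induction counts nonzero diagonal entries: elimination clears the pivot, and
  entries that are already zero stay zero.\<close>
proof (induction "card {j. A $ j $ j \<noteq> 0}" arbitrary: A rule: less_induct)
  case less
  have herm: "A $ i $ j = cnj (A $ j $ i)" for i j using less.prems unfolding psd_def by blast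
  then have hc: "cnj (A $ i $ j) = A $ j $ i" for i j by metis
  show ?case
  proof (cases "\<forall>j. A $ j $ j = 0")
    case True
    \<comment> \<open>In a positive semidefinite matrix the diagonal dominates: if it vanishes, so
      does every entry.\<close>
    then have "A $ i $ j = 0" for i j
      using psd_entry_bound[OF less.prems, of i j] by simp
    then have "A = (\<Sum>k<(0::nat). outer 0)" by (simp add: vec_eq_iff)
    then show ?thesis by (intro exI)
  next
    case False
    then obtain j where j: "A $ j $ j \<noteq> 0" by blast
    define a where "a = Re (A $ j $ j)"
    have ajj: "A $ j $ j = of_real a"
      using psd_diag[OF less.prems, of j] by (simp add: a_def complex_eq_iff)
    have "a \<ge> 0" using psd_diag(1)[OF less.prems, of j] by (simp add: a_def)
    moreover have "a \<noteq> 0" using j ajj by auto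
    ultimately have a: "a > 0" by simp
    define v where "v = (\<chi> i. A $ i $ j / of_real (sqrt a))"
    have ss: "complex_of_real (sqrt a) * of_real (sqrt a) = of_real a"
      using a by (simp flip: of_real_mult)
    define A' where "A' = A - outer v"
    have A': "A' $ i $ k = A $ i $ k - A $ i $ j * A $ j $ k / of_real a" for i k
      by (simp add: A'_def outer_def v_def ss hc)
    have psd': "psd A'"
      unfolding psd_iff
    proof (intro conjI allI)
      show "hermitian A'"
        by (simp add: A'_def hermitian_def outer_def hc)
      fix x
      define b where "b = (\<Sum>i\<in>UNIV. A $ j $ i * x $ i)"
      \<comment> \<open>Coordinate \<open>j\<close> is shifted so that \<open>A *v y\<close>
        vanishes there. The form of \<open>A\<close> at \<open>y\<close> is then the form of the
        Schur complement at \<open>x\<close>.\<close>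
      define y where "y = x - axis j (b / of_real a)"
      have bc: "(\<Sum>i\<in>UNIV. cnj (x $ i) * A $ i $ j) = cnj b"
        by (simp add: b_def hc mult.commute)
      have Ay: "(A *v y) $ i = (A *v x) $ i - A $ i $ j * (b / of_real a)" for i
        by (simp add: y_def matrix_vector_mult_diff_distrib mult_axis)
      have "qform A y = (\<Sum>i\<in>UNIV. cnj (y $ i) * (A *v y) $ i)"
        by (simp add: qform_def matrix_vector_mult_def sum_distrib_left mult.assoc)
      also have "\<dots> = (\<Sum>i\<in>UNIV. cnj (x $ i) * (A *v y) $ i) - cnj (b / of_real a) * (A *v y) $ j"
        by (simp add: y_def left_diff_distrib sum_subtractf sum_axis)
      also have "(A *v y) $ j = 0"
        unfolding Ay using a by (simp add: ajj b_def matrix_vector_mult_def)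
      also have "(\<Sum>i\<in>UNIV. cnj (x $ i) * (A *v y) $ i)
          = (\<Sum>i\<in>UNIV. cnj (x $ i) * (A *v x) $ i) - (\<Sum>i\<in>UNIV. cnj (x $ i) * A $ i $ j) * (b / of_real a)"
        unfolding Ay by (simp add: right_diff_distrib sum_subtractf sum_distrib_right sum_divide_distrib mult.assoc)
      also have "(\<Sum>i\<in>UNIV. cnj (x $ i) * (A *v x) $ i) = qform A x"
        by (simp add: qform_def matrix_vector_mult_def sum_distrib_left mult.assoc)
      finally have y: "qform A y = qform A x - cnj b * b / of_real a" by (simp add: bc)
      have "(\<Sum>i\<in>UNIV. cnj (v $ i) * x $ i) = b / of_real (sqrt a)"
        by (simp add: v_def b_def hc sum_divide_distrib)
      then have "qform (outer v) x = of_real ((norm b)\<^sup>2 / a)"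
        using a by (simp add: qform_outer norm_divide power_divide)
      also have "\<dots> = cnj b * b / of_real a"
        by (simp add: complex_norm_square mult.commute del: of_real_power)
      finally have "qform A' x = qform A y" by (simp add: A'_def qform_diff y)
      then show "0 \<le> Re (qform A' x)" using less.prems by (simp add: psd_iff)
    qed
    have jj: "A' $ j $ j = 0" using a by (simp add: A' ajj)
    \<comment> \<open>Elimination can only lower a diagonal entry, while \<open>psd A'\<close>
      forbids negative ones.\<close>
    have "A' $ i $ i = 0" if "A $ i $ i = 0" for i
    proof -
      have "A' $ i $ i = - (A $ i $ j * cnj (A $ i $ j)) / of_real a" by (simp add: A' that hc)
      also have "\<dots> = of_real (- (norm (A $ i $ j))\<^sup>2 / a)"
        by (simp add: complex_norm_square del: of_real_power)
      finally have "Re (A' $ i $ i) = - (norm (A $ i $ j))\<^sup>2 / a" by simp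
      then have "Re (A' $ i $ i) \<le> 0" using a by simp
      then show ?thesis using psd_diag[OF psd', of i] by (simp add: complex_eq_iff)
    qed
    then have "{j. A' $ j $ j \<noteq> 0} \<subset> {j. A $ j $ j \<noteq> 0}" using j jj by blast
    then have "card {j. A' $ j $ j \<noteq> 0} < card {j. A $ j $ j \<noteq> 0}"
      by (intro psubset_card_mono) auto
    from less.hyps[OF this psd'] obtain m w where "A' = (\<Sum>k<(m::nat). outer (w k))" by blast
    then have "A = (\<Sum>k<Suc m. outer ((w(m := v)) k))" by (simp add: A'_def algebra_simps)
    then show ?thesis by blast
  qed
qed

section \<open>Trace pairing, weak duality and congruence\<close>

lemma trace_psd_mult_nonneg:
  assumes "psd A" "psd B"
  shows "0 \<le> Re (trace (A ** B))"
proof -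
  obtain m v where "B = (\<Sum>k<(m::nat). outer (v k))" using psd_gram[OF assms(2)] by blast
  then show ?thesis using assms(1)
    by (simp add: matrix_mult_sum_right trace_sum trace_mult_outer psd_iff sum_nonneg)
qed

text \<open>Weak duality. Since the \<open>M i\<close> sum to the identity, the gap between the two
  sides is a sum of traces of products of positive semidefinite matrices.\<close>

lemma measurement_value_le_trace:
  fixes K :: "complex^'d^'d"
  assumes "measurement n M" "\<And>i. i < n \<Longrightarrow> psd (K - A i)"
  shows "(\<Sum>i<n. Re (trace (A i ** M i))) \<le> Re (trace K)"
proof -
  have "trace K = trace (K ** (\<Sum>i<n. M i))" using assms(1) by (simp add: measurement_def)
  also have "\<dots> = (\<Sum>i<n. trace (K ** M i))" by (simp add: matrix_mult_sum_right trace_sum)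
  finally have "Re (trace K) - (\<Sum>i<n. Re (trace (A i ** M i))) = (\<Sum>i<n. Re (trace ((K - A i) ** M i)))"
    by (simp add: sum_subtractf matrix_mult_diff trace_sub)
  also have "\<dots> \<ge> 0"
    using assms by (intro sum_nonneg trace_psd_mult_nonneg) (auto simp: measurement_def)
  finally show ?thesis by simp
qed

text \<open>A Hermitian \<open>X\<close> can be moved onto both copies of \<open>y\<close>. The
  chain of swaps only brings the four summation indices into the order in which the right side
  unfolds.\<close>

lemma qform_congruence:
  assumes "hermitian X"
  shows "qform (X ** M ** X) y = qform M (X *v y)"
proof -
  have h: "cnj (X $ i $ j) = X $ j $ i" for i j using assms unfolding hermitian_def by metis
  have "qform (X ** M ** X) y = (\<Sum>i\<in>UNIV. \<Sum>j\<in>UNIV. \<Sum>k\<in>UNIV. \<Sum>l\<in>UNIV.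
      cnj (y $ i) * X $ i $ l * M $ l $ k * X $ k $ j * y $ j)"
    by (simp add: qform_def matrix_matrix_mult_def sum_distrib_left sum_distrib_right mult.assoc)
  also have "\<dots> = (\<Sum>i\<in>UNIV. \<Sum>k\<in>UNIV. \<Sum>j\<in>UNIV. \<Sum>l\<in>UNIV.
      cnj (y $ i) * X $ i $ l * M $ l $ k * X $ k $ j * y $ j)"
    by (rule sum.cong[OF refl]) (rule sum.swap)
  also have "\<dots> = (\<Sum>i\<in>UNIV. \<Sum>k\<in>UNIV. \<Sum>l\<in>UNIV. \<Sum>j\<in>UNIV.
      cnj (y $ i) * X $ i $ l * M $ l $ k * X $ k $ j * y $ j)"
    by (rule sum.cong[OF refl], rule sum.cong[OF refl]) (rule sum.swap)
  also have "\<dots> = (\<Sum>i\<in>UNIV. \<Sum>l\<in>UNIV. \<Sum>k\<in>UNIV. \<Sum>j\<in>UNIV.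
      cnj (y $ i) * X $ i $ l * M $ l $ k * X $ k $ j * y $ j)"
    by (rule sum.cong[OF refl]) (rule sum.swap)
  also have "\<dots> = (\<Sum>l\<in>UNIV. \<Sum>i\<in>UNIV. \<Sum>k\<in>UNIV. \<Sum>j\<in>UNIV.
      cnj (y $ i) * X $ i $ l * M $ l $ k * X $ k $ j * y $ j)"
    by (rule sum.swap)
  also have "\<dots> = (\<Sum>l\<in>UNIV. \<Sum>k\<in>UNIV. \<Sum>i\<in>UNIV. \<Sum>j\<in>UNIV.
      cnj (y $ i) * X $ i $ l * M $ l $ k * X $ k $ j * y $ j)"
    by (rule sum.cong[OF refl]) (rule sum.swap)
  also have "\<dots> = qform M (X *v y)"
    by (simp add: qform_def matrix_vector_mult_def sum_distrib_left sum_distrib_right h mult_ac)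
  finally show ?thesis .
qed

lemma hermitian_congruence:
  assumes "hermitian X" "hermitian M"
  shows "hermitian (X ** M ** X)"
proof -
  have h: "cnj (X $ i $ j) = X $ j $ i" "cnj (M $ i $ j) = M $ j $ i" for i j
    using assms unfolding hermitian_def by metis+
  show ?thesis unfolding hermitian_def
  proof (intro allI)
    fix i j
    have "cnj ((X ** M ** X) $ j $ i) = (X ** (M ** X)) $ i $ j"
      by (simp add: matrix_matrix_mult_def h mult_ac)
    then show "cnj ((X ** M ** X) $ j $ i) = (X ** M ** X) $ i $ j"
      by (simp add: matrix_mul_assoc)
  qed
qed

lemma psd_congruence: "hermitian X \<Longrightarrow> psd M \<Longrightarrow> psd (X ** M ** X)"
  by (simp add: psd_iff hermitian_congruence qform_congruence)

section \<open>Semidefinite duality for measurements\<close>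

text \<open>Conjugation reverses the product and cyclicity of the trace restores it. This makes the
  trace of the dual operator equal to the real optimal value.\<close>

lemma trace_mult_hermitian_real:
  assumes "hermitian A" "hermitian B"
  shows "trace (A ** B) \<in> \<real>"
proof -
  have "cnj (trace (A ** B)) = trace (B ** A)"
    using assms by (simp add: trace_def matrix_matrix_mult_def hermitian_def mult.commute)
  then have "cnj (trace (A ** B)) = trace (A ** B)" by (metis trace_mul_sym)
  then show ?thesis by (simp add: Reals_cnj_iff)
qed

lemma outer_mult_outer:
  "outer x ** outer x = (\<Sum>i\<in>UNIV. (norm (x $ i))\<^sup>2) *\<^sub>R outer x"
proof -
  have "(outer x ** outer x) $ i $ j = of_real (\<Sum>i\<in>UNIV. (norm (x $ i))\<^sup>2) * outer x $ i $ j" for i j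
    by (simp add: outer_def matrix_matrix_mult_def complex_norm_square sum_distrib_left
        sum_distrib_right mult_ac del: of_real_power)
  then show ?thesis
    by (simp only: vec_eq_iff vector_scaleR_component) (simp add: scaleR_conv_of_real)
qed

lemma hermitian_mat1: "hermitian (mat 1)"
  by (auto simp: hermitian_def mat_def)

lemma hermitian_diff_scaleR:
  "hermitian A \<Longrightarrow> hermitian B \<Longrightarrow> hermitian (A - B)"
  "hermitian A \<Longrightarrow> hermitian (r *\<^sub>R A)"
  by (simp_all add: hermitian_def)

lemma hermitian_sum: "(\<And>k. k \<in> S \<Longrightarrow> hermitian (A k)) \<Longrightarrow> hermitian (\<Sum>k\<in>S. A k)"
  by (simp add: hermitian_def)

lemma hermitian_anticommutator:
  assumes "hermitian A" "hermitian B"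
  shows "hermitian (A ** B + B ** A)"
  using assms by (simp add: hermitian_def matrix_matrix_mult_def mult.commute add.commute)

text \<open>First-order optimality: if \<open>K - A j\<close> had a negative expectation in the direction \<open>x\<close>, then
  replacing \<open>M i\<close> by \<open>X ** M i ** X\<close> with \<open>X = mat 1 - t *\<^sub>R outer x\<close>, and
  returning the missing weight \<open>mat 1 - X ** X\<close> to outcome \<open>j\<close>, would increase the value.\<close>

lemma optimal_measurement_dual:
  fixes A :: "nat \<Rightarrow> complex^'d^'d"
  assumes A: "\<And>i. i < n \<Longrightarrow> hermitian (A i)"
    and M: "measurement n M"
    and opt: "\<And>N. measurement n N \<Longrightarrow>
      (\<Sum>i<n. Re (trace (A i ** N i))) \<le> (\<Sum>i<n. Re (trace (A i ** M i)))"
  obtains K where "\<And>j. j < n \<Longrightarrow> psd (K - A j)"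
    and "trace K = of_real (\<Sum>i<n. Re (trace (A i ** M i)))"
proof
  \<comment> \<open>Symmetrising makes \<open>K\<close> Hermitian at once, with no need to show that
    the sum of the \<open>A i ** M i\<close> is Hermitian at an optimum.\<close>
  define K where "K = (1/2) *\<^sub>R (\<Sum>i<n. A i ** M i + M i ** A i)"
  have hM: "hermitian (M i)" if "i < n" for i using M that by (simp add: measurement_def psd_iff)
  have hK: "hermitian K"
    unfolding K_def using A hM
    by (intro hermitian_diff_scaleR hermitian_sum hermitian_anticommutator) auto
  show "trace K = of_real (\<Sum>i<n. Re (trace (A i ** M i)))"
  proof -
    have "trace (M i ** A i) = trace (A i ** M i)" for i by (rule trace_mul_sym)
    then have "trace K = (\<Sum>i<n. trace (A i ** M i))"
      by (simp add: K_def trace_scaleR trace_sum trace_add sum.distrib scaleR_2 flip: mult_2)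
    also have "\<dots> = (\<Sum>i<n. of_real (Re (trace (A i ** M i))))"
      by (rule sum.cong) (auto simp: A hM trace_mult_hermitian_real)
    finally show ?thesis by simp
  qed
  fix j assume j: "j < n"
  show "psd (K - A j)"
    unfolding psd_iff
  proof (intro conjI allI)
    show "hermitian (K - A j)" using hK A[OF j] by (rule hermitian_diff_scaleR)
    fix x
    show "0 \<le> Re (qform (K - A j) x)"
    proof (rule ccontr)
      assume neg: "\<not> 0 \<le> Re (qform (K - A j) x)"
      \<comment> \<open>The perturbed measurement \<open>N\<close> will gain
        \<open>t * \<delta> + t\<^sup>2 * e\<close>, with \<open>e\<close> as defined below;
        \<open>\<delta>\<close> is the first-order coefficient.\<close>
      define \<delta> where "\<delta> = - 2 * Re (qform (K - A j) x)"
      have \<delta>: "\<delta> > 0" using neg by (simp add: \<delta>_def)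
      define P where "P = outer x"
      define c where "c = (\<Sum>i\<in>UNIV. (norm (x $ i))\<^sup>2)"
      have c: "c \<ge> 0" by (simp add: c_def sum_nonneg)
      have PP: "P ** P = c *\<^sub>R P" by (simp add: P_def c_def outer_mult_outer)
      define e where "e = (\<Sum>i<n. Re (trace (A i ** P ** M i ** P))) - c * Re (qform (A j) x)"
      \<comment> \<open>The first bound gives \<open>t * c \<le> 2\<close>, hence
        \<open>s \<ge> 0\<close>; the second makes the second-order term too small to cancel
        \<open>\<delta>\<close>. Adding 1 keeps both denominators positive.\<close>
      define t where "t = min (2 / (c + 1)) (\<delta> / (2 * (\<bar>e\<bar> + 1)))"
      have t: "t > 0" using c \<delta> by (simp add: t_def)
      have "t * c \<le> 2 / (c + 1) * c" using c by (intro mult_right_mono) (auto simp: t_def)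
      also have "\<dots> \<le> 2" using c by (simp add: field_simps)
      finally have tc: "t * c \<le> 2" .
      define X where "X = mat 1 - t *\<^sub>R P"
      \<comment> \<open>By \<open>P ** P = c *\<^sub>R P\<close>, the missing weight
        \<open>mat 1 - X ** X\<close> is exactly \<open>s *\<^sub>R P\<close>.\<close>
      define s where "s = t * (2 - t * c)"
      define N where "N = (\<lambda>i. X ** M i ** X + (if i = j then s *\<^sub>R P else 0))"
      have s: "s = t + t - t * t * c" by (simp add: s_def algebra_simps)
      have "X ** X = mat 1 - s *\<^sub>R P"
        unfolding s scaleR_left_diff_distrib scaleR_left_distrib
        by (simp add: X_def matrix_mult_diff scaleR_matrix_mult PP algebra_simps)
      moreover have "(\<Sum>i<n. X ** M i ** X) = X ** (\<Sum>i<n. M i) ** X"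
        by (simp only: matrix_mult_sum_right matrix_mult_sum_left)
      ultimately have "(\<Sum>i<n. N i) = mat 1"
        using M j by (simp add: N_def sum.distrib measurement_def)
      moreover have "psd (N i)" if "i < n" for i
      proof -
        have "hermitian X" by (simp add: X_def P_def hermitian_diff_scaleR hermitian_mat1 hermitian_outer)
        moreover have "0 \<le> s" using t tc by (simp add: s_def)
        ultimately show ?thesis using M that
          by (auto simp: N_def measurement_def P_def intro!: psd_add psd_scaleR psd_congruence psd_outer psd_zero)
      qed
      ultimately have "measurement n N" by (simp add: measurement_def)
      \<comment> \<open>Expansion in powers of \<open>t\<close>. Cyclicity turns the linear terms
        into quadratic forms at \<open>x\<close>, which add up over \<open>i\<close> to
        \<open>2 * qform K x\<close>.\<close>
      have exp: "trace (A i ** (X ** M i ** X)) = trace (A i ** M i)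
          - t *\<^sub>R qform (A i ** M i + M i ** A i) x + t\<^sup>2 *\<^sub>R trace (A i ** P ** M i ** P)" for i
      proof -
        have "trace (A i ** (P ** M i)) = trace (M i ** A i ** P)"
          by (metis matrix_mul_assoc trace_mul_sym)
        then have 1: "trace (A i ** (P ** M i)) = qform (M i ** A i) x"
          by (simp add: P_def trace_mult_outer)
        have 2: "trace (A i ** (M i ** P)) = qform (A i ** M i) x"
          by (simp add: P_def trace_mult_outer matrix_mul_assoc)
        have 3: "A i ** (X ** M i ** X) = A i ** M i - t *\<^sub>R (A i ** (P ** M i)) - t *\<^sub>R (A i ** (M i ** P))
            + t\<^sup>2 *\<^sub>R (A i ** P ** M i ** P)"
          by (simp add: X_def matrix_mult_diff scaleR_matrix_mult matrix_add_ldistrib algebra_simps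
              power2_eq_square matrix_mul_assoc)
        show ?thesis
          unfolding 3 trace_add trace_sub trace_scaleR 1 2 qform_add
          by (simp add: algebra_simps)
      qed
      have "(\<Sum>i<n. trace (A i ** N i)) = (\<Sum>i<n. trace (A i ** (X ** M i ** X))) + s *\<^sub>R qform (A j) x"
      proof -
        have "trace (A i ** N i) = trace (A i ** (X ** M i ** X)) + (if i = j then s *\<^sub>R qform (A j) x else 0)" for i
          by (simp add: N_def matrix_add_ldistrib trace_add trace_zero scaleR_matrix_mult trace_scaleR P_def trace_mult_outer)
        then show ?thesis using j by (simp add: sum.distrib)
      qed
      also have "(\<Sum>i<n. trace (A i ** (X ** M i ** X)))
          = (\<Sum>i<n. trace (A i ** M i)) - (2 * t) *\<^sub>R qform K x
            + t\<^sup>2 *\<^sub>R (\<Sum>i<n. trace (A i ** P ** M i ** P))"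
      proof -
        have "(2 * t) *\<^sub>R qform K x = t *\<^sub>R (\<Sum>i<n. qform (A i ** M i + M i ** A i) x)"
          unfolding K_def qform_scaleR qform_sum by simp
        then show ?thesis
          by (simp only: exp sum.distrib sum_subtractf scaleR_sum_right)
      qed
      finally have sumN: "(\<Sum>i<n. trace (A i ** N i)) = (\<Sum>i<n. trace (A i ** M i))
          - (2 * t) *\<^sub>R qform K x + t\<^sup>2 *\<^sub>R (\<Sum>i<n. trace (A i ** P ** M i ** P))
          + s *\<^sub>R qform (A j) x" .
      from arg_cong[OF sumN, of Re] have "(\<Sum>i<n. Re (trace (A i ** N i))) = (\<Sum>i<n. Re (trace (A i ** M i))) + (t * \<delta> + t\<^sup>2 * e)"
        by (simp add: e_def \<delta>_def s_def qform_diff algebra_simps power2_eq_square)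
      with opt[OF \<open>measurement n N\<close>] have "t * (\<delta> + t * e) \<le> 0"
        by (simp add: algebra_simps power2_eq_square)
      moreover have "t * \<bar>e\<bar> < \<delta>"
      proof -
        have "t * \<bar>e\<bar> \<le> \<delta> / (2 * (\<bar>e\<bar> + 1)) * \<bar>e\<bar>" by (intro mult_right_mono) (auto simp: t_def)
        also have "\<dots> < \<delta>" using \<delta> by (simp add: divide_less_eq)
        finally show ?thesis .
      qed
      then have "t * e > - \<delta>" using abs_ge_minus_self[of e] t by (smt (verit) mult_left_mono minus_mult_right)
      then have "t * (\<delta> + t * e) > 0" using t by simp
      ultimately show False by simp
    qed
  qed
qed

section \<open>Sums over strings of fixed residue\<close>

text \<open>The summands are powers of one \<open>n\<close>-th root of unity \<open>z\<close>, which
  equals 1 exactly when \<open>m\<close> and \<open>i\<close> are congruent modulo \<open>n\<close>;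
  otherwise the geometric sum vanishes.\<close>

lemma sum_root_of_unity_filter:
  fixes m i n :: nat
  assumes n: "n > 0" and i: "i < n"
  defines "w \<equiv> cis (2 * pi / real n)"
  shows "(\<Sum>k<n. w ^ (k * m) * inverse w ^ (k * i)) = (if m mod n = i then of_nat n else 0)"
proof -
  have w0: "w \<noteq> 0" by (simp add: w_def)
  define z where "z = w ^ m * inverse w ^ i"
  have z: "w ^ (k * m) * inverse w ^ (k * i) = z ^ k" for k
    by (simp add: z_def power_mult_distrib mult.commute[of k] power_mult flip: power_inverse)
  have zc: "z = cis (2 * pi * (real_of_int (int m - int i) / real n))"
    unfolding z_def w_def cis_inverse Complex.DeMoivre cis_mult
    by (simp add: diff_divide_distrib algebra_simps)
  have "z ^ n = cis (2 * pi * real_of_int (int m - int i))"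
    unfolding zc Complex.DeMoivre using n by simp
  also have "\<dots> = 1" by (rule cis_multiple_2pi) simp
  finally have zn: "z ^ n = 1" .
  have z1: "z = 1 \<longleftrightarrow> m mod n = i"
  proof
    assume "z = 1"
    then have "cos (2 * pi * (real_of_int (int m - int i) / real n)) = 1"
      unfolding zc by (simp add: complex_eq_iff)
    then obtain q :: int where "2 * pi * (real_of_int (int m - int i) / real n) = of_int q * 2 * pi"
      by (auto simp: cos_one_2pi_int)
    then have "2 * pi * (real_of_int (int m - int i) / real n) = 2 * pi * of_int q"
      by (simp only: mult_ac)
    then have "real_of_int (int m - int i) / real n = of_int q"
      unfolding mult_cancel_left by simp
    then have "real_of_int (int m - int i) = real_of_int (q * int n)"
      using n by (simp add: field_simps)
    then have "int m - int i = q * int n" by (simp only: of_int_eq_iff)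
    then have "int m mod int n = int i mod int n"
      by (simp add: mod_eq_dvd_iff)
    then show "m mod n = i" using i by (metis mod_less of_nat_eq_iff zmod_int)
  next
    assume "m mod n = i"
    then have "int m - int i = int (m div n) * int n"
      using div_mult_mod_eq[of m n] by (metis add_diff_cancel_right' of_nat_add of_nat_mult)
    then have "real_of_int (int m - int i) / real n = real (m div n)"
      using n by simp
    then show "z = 1" unfolding zc by (simp add: cis_multiple_2pi)
  qed
  show ?thesis
  proof (cases "z = 1")
    case True
    then show ?thesis using z1 by (simp add: z)
  next
    case False
    then show ?thesis using z1 by (simp add: z sum_gp_strict zn)
  qed
qed

lemma finite_strings: "finite (strings n i :: ('l::finite \<Rightarrow> nat) set)"
proof (rule finite_subset)
  show "(strings n i :: ('l \<Rightarrow> nat) set) \<subseteq> Pi\<^sub>E UNIV (\<lambda>_. {..<n})" by (auto simp: strings_def)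
qed (auto intro: finite_PiE)

text \<open>The filter trades the residue constraint for a sum over frequencies \<open>k\<close>. At
  each frequency the phase of a string is a product over its letters, so the unconstrained sum over
  strings factorises.\<close>

lemma sum_strings_filter:
  fixes a :: "'l::finite \<Rightarrow> nat \<Rightarrow> complex"
  assumes n: "n > 0" and i: "i < n"
  defines "w \<equiv> cis (2 * pi / real n)"
  shows "of_nat n * (\<Sum>c\<in>strings n i. \<Prod>l\<in>UNIV. a l (c l))
    = (\<Sum>k<n. inverse w ^ (k * i) * (\<Prod>l\<in>UNIV. \<Sum>j<n. w ^ (k * j) * a l j))"
proof -
  let ?C = "Pi\<^sub>E (UNIV :: 'l set) (\<lambda>_. {..<n})"
  have fC: "finite ?C" by (auto intro: finite_PiE)
  have "(\<Sum>k<n. inverse w ^ (k * i) * (\<Prod>l\<in>UNIV. \<Sum>j<n. w ^ (k * j) * a l j))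
      = (\<Sum>k<n. \<Sum>c\<in>?C. inverse w ^ (k * i) * (\<Prod>l\<in>UNIV. w ^ (k * c l) * a l (c l)))"
    by (simp add: prod_sum_PiE sum_distrib_left)
  also have "\<dots> = (\<Sum>c\<in>?C. \<Sum>k<n. inverse w ^ (k * i) * (\<Prod>l\<in>UNIV. w ^ (k * c l) * a l (c l)))"
    by (rule sum.swap)
  also have "\<dots> = (\<Sum>c\<in>?C. (\<Sum>k<n. w ^ (k * (\<Sum>l\<in>UNIV. c l)) * inverse w ^ (k * i)) * (\<Prod>l\<in>UNIV. a l (c l)))"
    by (simp add: prod.distrib sum_distrib_left sum_distrib_right power_sum mult_ac)
  also have "\<dots> = (\<Sum>c\<in>?C. if c \<in> strings n i then of_nat n * (\<Prod>l\<in>UNIV. a l (c l)) else 0)"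
    unfolding w_def sum_root_of_unity_filter[OF n i]
    by (rule sum.cong) (auto simp: strings_def)
  also have "\<dots> = (\<Sum>c\<in>?C \<inter> strings n i. of_nat n * (\<Prod>l\<in>UNIV. a l (c l)))"
    using fC by (simp add: sum.inter_restrict)
  also have "?C \<inter> strings n i = strings n i" by (auto simp: strings_def)
  finally show ?thesis by (simp add: sum_distrib_left)
qed

text \<open>Only the frequency \<open>k = 0\<close> of the filter sees the common term \<open>x l\<close>.\<close>

lemma sum_strings_diff_const:
  fixes b :: "'l::finite \<Rightarrow> nat \<Rightarrow> complex"
  assumes n: "n > 0" and i: "i < n"
  shows "of_nat n * (\<Sum>c\<in>strings n i. \<Prod>l\<in>UNIV. x l - b l (c l))
    = (\<Prod>l\<in>UNIV. \<Sum>j<n. x l - b l j)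
      + (- 1) ^ CARD('l) * (of_nat n * (\<Sum>c\<in>strings n i. \<Prod>l\<in>UNIV. b l (c l))
         - (\<Prod>l\<in>UNIV. \<Sum>j<n. b l j))"
proof -
  define w where "w = cis (2 * pi / real n)"
  define f where "f a k = inverse w ^ (k * i) * (\<Prod>l\<in>UNIV. \<Sum>j<n. w ^ (k * j) * a l j)"
    for a :: "'l \<Rightarrow> nat \<Rightarrow> complex" and k
  have F: "of_nat n * (\<Sum>c\<in>strings n i. \<Prod>l\<in>UNIV. a l (c l))
      = (\<Prod>l\<in>UNIV. \<Sum>j<n. a l j) + (\<Sum>k\<in>{..<n} - {0}. f a k)" for a :: "'l \<Rightarrow> nat \<Rightarrow> complex"
  proof -
    have "(\<Sum>k<n. f a k) = f a 0 + (\<Sum>k\<in>{..<n} - {0}. f a k)"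
      using n by (simp add: sum.remove)
    then show ?thesis using sum_strings_filter[OF n i, of a] by (simp add: f_def w_def)
  qed
  have "f (\<lambda>l j. x l - b l j) k = (- 1) ^ CARD('l) * f b k" if k: "k \<in> {..<n} - {0}" for k
  proof -
    \<comment> \<open>The filter for residue 0 at exponent \<open>k\<close>, where
      \<open>0 < k < n\<close>. The common term thus drops out and each copy contributes one factor
      -1.\<close>
    have "(\<Sum>j<n. w ^ (k * j)) = 0"
      using sum_root_of_unity_filter[OF n n, of k] k n sum_root_of_unity_filter[of n 0 k]
      by (simp add: w_def mult.commute)
    then have "(\<Sum>j<n. w ^ (k * j) * (x l - b l j)) = - (\<Sum>j<n. w ^ (k * j) * b l j)" for l
      by (simp add: right_diff_distrib sum_subtractf flip: sum_distrib_right)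
    then show ?thesis by (simp add: f_def prod_uminus)
  qed
  then have "(\<Sum>k\<in>{..<n} - {0}. f (\<lambda>l j. x l - b l j) k)
      = (- 1) ^ CARD('l) * (\<Sum>k\<in>{..<n} - {0}. f b k)"
    by (simp add: sum_distrib_left)
  with F[of "\<lambda>l j. x l - b l j"] F[of b] show ?thesis by simp
qed

section \<open>Tensor products and the multi-copy ensemble\<close>

text \<open>A tensor product of rank-one matrices \<open>outer v\<close> has the same form.
  Expanding Gram decompositions of all factors gives one such term for each choice
  \<open>\<kappa>\<close> of a summand in every copy.\<close>

lemma psd_tensor_copies:
  fixes R :: "'l::finite \<Rightarrow> complex^('a::finite \<times> 'b::finite)^('a \<times> 'b)"
  assumes "\<And>l. psd (R l)"
  shows "psd (tensor_copies R)"
proof -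
  have "\<forall>l. \<exists>m v. R l = (\<Sum>k<(m::nat). outer (v k))" using psd_gram assms by blast
  then obtain m v where R: "\<And>l. R l = (\<Sum>k<(m l :: nat). outer (v l k))" by metis
  have "tensor_copies R = (\<Sum>\<kappa>\<in>Pi\<^sub>E UNIV (\<lambda>l. {..<m l}).
      outer (\<chi> p. \<Prod>l\<in>UNIV. v l (\<kappa> l) $ (fst p l, snd p l)))"
    by (simp add: tensor_copies_def R vec_eq_iff outer_def prod_sum_PiE prod.distrib)
  then show ?thesis by (auto intro!: psd_sum psd_outer)
qed

lemma trace_tensor_copies:
  fixes R :: "'l::finite \<Rightarrow> complex^('a::finite \<times> 'b::finite)^('a \<times> 'b)"
  shows "trace (tensor_copies R) = (\<Prod>l\<in>UNIV. trace (R l))"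
proof -
  have "(\<Prod>l\<in>UNIV. trace (R l)) = (\<Sum>g\<in>Pi\<^sub>E UNIV (\<lambda>_. UNIV). \<Prod>l\<in>UNIV. R l $ g l $ g l)"
    unfolding trace_def by (rule prod_sum_PiE) auto
  also have "\<dots> = (\<Sum>g\<in>UNIV. \<Prod>l\<in>UNIV. R l $ g l $ g l)" by (simp add: PiE_UNIV_domain)
  \<comment> \<open>The product of traces runs over strings of index pairs, the tensor power over
    pairs of index strings; the witnesses are the zipping bijection and its inverse.\<close>
  also have "\<dots> = (\<Sum>p\<in>UNIV. \<Prod>l\<in>UNIV. R l $ (fst p l, snd p l) $ (fst p l, snd p l))"
    by (rule sum.reindex_bij_witness[where i = "\<lambda>p l. (fst p l, snd p l)"
          and j = "\<lambda>g. (\<lambda>l. fst (g l), \<lambda>l. snd (g l))"]) auto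
  finally show ?thesis by (simp add: trace_def tensor_copies_def)
qed

lemma tensor_copies_scaleR:
  "tensor_copies (\<lambda>l. r l *\<^sub>R R l) = (\<Prod>l\<in>UNIV. r l) *\<^sub>R tensor_copies R"
  by (simp only: vec_eq_iff vector_scaleR_component tensor_copies_def vec_lambda_beta)
    (simp add: scaleR_conv_of_real prod.distrib)

lemma tensor_copies_sum:
  fixes B :: "nat \<Rightarrow> complex^('a::finite \<times> 'b::finite)^('a \<times> 'b)"
  shows "tensor_copies (\<lambda>l::'l::finite. \<Sum>j<n. B j)
    = (\<Sum>c\<in>Pi\<^sub>E UNIV (\<lambda>_. {..<n}). tensor_copies (\<lambda>l. B (c l)))"
  by (simp add: tensor_copies_def vec_eq_iff prod_sum_PiE)

section \<open>Partial transposition and the weighted multi-copy states\<close>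

lemma trace_partial_transpose: "trace (partial_transpose A) = trace A"
  by (simp add: trace_def partial_transpose_def)

lemma hermitian_partial_transpose: "hermitian A \<Longrightarrow> hermitian (partial_transpose A)"
  by (simp add: hermitian_def partial_transpose_def)

lemma partial_transpose_scaleR: "partial_transpose (r *\<^sub>R A) = r *\<^sub>R partial_transpose A"
  by (simp add: partial_transpose_def vec_eq_iff)

lemma partial_transpose_sum:
  "partial_transpose (\<Sum>c\<in>S. A c) = (\<Sum>c\<in>S. partial_transpose (A c))"
  by (simp add: partial_transpose_def vec_eq_iff)

text \<open>The prior cancels the normalisation. If it is zero, every string of that residue has
  weight zero by nonnegativity, so both sides vanish whatever \<open>\<sigma>\<close> is.\<close>

lemma multi_state_weighted:
  fixes \<rho> :: "nat \<Rightarrow> complex^('a::finite \<times> 'b::finite)^('a \<times> 'b)"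
    and \<sigma> :: "nat \<Rightarrow> complex^(('l::finite \<Rightarrow> 'a) \<times> ('l \<Rightarrow> 'b))^(('l \<Rightarrow> 'a) \<times> ('l \<Rightarrow> 'b))"
  assumes "\<And>j. j < n \<Longrightarrow> 0 \<le> \<eta> j"
  shows "multi_prior TYPE('l) n \<eta> i *\<^sub>R partial_transpose (multi_state n \<eta> \<rho> \<sigma> i)
    = (\<Sum>c\<in>strings n i. tensor_copies (\<lambda>l. \<eta> (c l) *\<^sub>R partial_transpose (\<rho> (c l))))"
proof (cases "multi_prior TYPE('l) n \<eta> i = 0")
  case False
  then show ?thesis
    by (simp add: multi_state_def partial_transpose_scaleR partial_transpose_sum
        partial_transpose_tensor_copies tensor_copies_scaleR)
next
  case True
  have z: "(\<Prod>l\<in>UNIV. \<eta> (c l)) = 0" if "c \<in> strings n i" for c :: "'l \<Rightarrow> nat"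
  proof -
    have "\<forall>c\<in>(strings n i :: ('l \<Rightarrow> nat) set). (\<Prod>l\<in>UNIV. \<eta> (c l)) = 0"
      using True unfolding multi_prior_def
      by (subst (asm) sum_nonneg_eq_0_iff)
        (use assms in \<open>auto simp: finite_strings intro!: prod_nonneg, simp add: strings_def\<close>)
    then show ?thesis using that by blast
  qed
  have "(\<Sum>c\<in>strings n i. tensor_copies (\<lambda>l::'l. \<eta> (c l) *\<^sub>R partial_transpose (\<rho> (c l)))) = 0"
    unfolding tensor_copies_scaleR using z by (intro sum.neutral ballI) (simp del: prod_zero_iff)
  then show ?thesis using True by simp
qed

theorem theorem4:
  fixes n :: nat
    and \<eta> :: "nat \<Rightarrow> real"
    and \<rho> :: "nat \<Rightarrow> complex^('a::finite \<times> 'b::finite)^('a \<times> 'b)"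
    and \<sigma> :: "nat \<Rightarrow> complex^(('l::finite \<Rightarrow> 'a) \<times> ('l \<Rightarrow> 'b))^(('l \<Rightarrow> 'a) \<times> ('l \<Rightarrow> 'b))"
  assumes "ensemble n \<eta> \<rho>"
    and "\<forall>i<n. multi_prior TYPE('l) n \<eta> i = 0 \<longrightarrow> density_operator (\<sigma> i)"
  shows "q_G n (multi_prior TYPE('l) n \<eta>) (multi_state n \<eta> \<rho> \<sigma>)
     \<le> 1 / real n + (real n - 1) / real n * (real n * q_G n \<eta> \<rho> - 1) ^ CARD('l)"
proof -
  have n: "n > 0" using assms(1) by (cases n) (auto simp: ensemble_def)
  define q where "q = q_G n \<eta> \<rho>"
  define A where "A j = \<eta> j *\<^sub>R partial_transpose (\<rho> j)" for j
  have hA: "hermitian (A j)" if "j < n" for j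
    using assms(1) that
    by (simp add: A_def ensemble_def density_operator_def psd_iff hermitian_diff_scaleR hermitian_partial_transpose)
  have succ: "pt_success n \<eta> \<rho> M = (\<Sum>j<n. Re (trace (A j ** M j)))" for M
    by (simp add: pt_success_def A_def scaleR_matrix_mult trace_scaleR)
  obtain M where M: "measurement n M" "q = pt_success n \<eta> \<rho> M"
    using q_G_is_max(1)[OF n, of \<eta> \<rho>] unfolding q_def by blast
  have opt: "(\<Sum>i<n. Re (trace (A i ** N i))) \<le> (\<Sum>i<n. Re (trace (A i ** M i)))" if "measurement n N" for N
    using q_G_is_max(2)[OF n that, of \<eta> \<rho>] M(2) by (simp add: succ q_def)
  obtain K where K: "\<And>j. j < n \<Longrightarrow> psd (K - A j)" "trace K = of_real q"
    using optimal_measurement_dual[OF hA M(1) opt] M(2) succ by metis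
  define B where "B j = K - A j" for j
  define S where "S = (\<Sum>j<n. A j)"
  have "trace (A j) = of_real (\<eta> j)" if "j < n" for j
    using assms(1) that
    by (simp add: A_def trace_scaleR trace_partial_transpose ensemble_def density_operator_def
        of_real_def)
  then have trS: "trace S = 1"
    using assms(1) by (simp add: S_def trace_sum ensemble_def flip: of_real_sum)
  have trB: "trace (\<Sum>j<n. B j) = of_real (real n * q - 1)"
  proof -
    have "(\<Sum>j<n. B j) = real n *\<^sub>R K - S"
      unfolding B_def S_def sum_subtractf sum_constant_scaleR by simp
    then have "trace (\<Sum>j<n. B j) = real n *\<^sub>R trace K - trace S"
      by (simp only: trace_sub trace_scaleR)
    then show ?thesis by (simp add: K trS scaleR_conv_of_real)
  qed
  define TS where "TS = tensor_copies (\<lambda>l::'l. S)"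
  define TB where "TB = tensor_copies (\<lambda>l::'l. \<Sum>j<n. B j)"
  define G where "G i = (\<Sum>c\<in>strings n i. tensor_copies (\<lambda>l::'l. A (c l)))" for i
  define F where "F i = (\<Sum>c\<in>strings n i. tensor_copies (\<lambda>l::'l. B (c l)))" for i
  define KL where "KL = (1 / real n) *\<^sub>R TS + ((real n - 1) / real n) *\<^sub>R TB"
  have tpsd: "psd (tensor_copies (\<lambda>l::'l. B (c l)))" if "\<And>l. c l < n" for c
    using K(1) that by (auto simp: B_def intro!: psd_tensor_copies)
  have psdF: "psd (F i)" for i
    unfolding F_def by (intro psd_sum tpsd) (auto simp: strings_def)
  \<comment> \<open>\<open>TB\<close> expands over all strings and \<open>F i\<close> over those of
    residue \<open>i\<close>, so the difference collects the other residues. For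
    \<open>n = 1\<close> there are none.\<close>
  have psdTBF: "psd (TB - F i)" and TBF: "n = 1 \<Longrightarrow> i < n \<Longrightarrow> TB = F i" for i
  proof -
    let ?C = "Pi\<^sub>E (UNIV :: 'l set) (\<lambda>_. {..<n})"
    have "strings n i \<subseteq> ?C" "finite ?C" by (auto simp: strings_def intro: finite_PiE)
    then have "TB - F i = (\<Sum>c\<in>?C - strings n i. tensor_copies (\<lambda>l. B (c l)))"
      unfolding TB_def F_def tensor_copies_sum by (subst sum_diff) auto
    then show "psd (TB - F i)" by (auto intro!: psd_sum tpsd)
    show "TB = F i" if "n = 1" "i < n"
      unfolding TB_def F_def tensor_copies_sum using that
      by (intro sum.cong) (auto simp: strings_def)
  qed
  \<comment> \<open>Entrywise this is \<open>sum_strings_diff_const\<close> with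
    \<open>A j = K - B j\<close>: the entries of \<open>K\<close> are the common term and drop out
    of all nonzero frequencies.\<close>
  have key: "real n *\<^sub>R G i = TS + (- 1) ^ CARD('l) *\<^sub>R (real n *\<^sub>R F i - TB)" if i: "i < n" for i
  proof -
    have "(real n *\<^sub>R G i) $ p $ r = (TS + (- 1) ^ CARD('l) *\<^sub>R (real n *\<^sub>R F i - TB)) $ p $ r" for p r
    proof -
      define e where "e l X = X $ (fst p l, snd p l) $ (fst r l, snd r l)"
        for l :: 'l and X :: "complex^('a \<times> 'b)^('a \<times> 'b)"
      have AB: "A j = K - B j" for j by (simp add: B_def)
      have "of_nat n * (\<Sum>c\<in>strings n i. \<Prod>l\<in>UNIV. e l K - e l (B (c l)))
        = (\<Prod>l\<in>UNIV. \<Sum>j<n. e l K - e l (B j))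
          + (- 1) ^ CARD('l) * (of_nat n * (\<Sum>c\<in>strings n i. \<Prod>l\<in>UNIV. e l (B (c l)))
             - (\<Prod>l\<in>UNIV. \<Sum>j<n. e l (B j)))"
        by (rule sum_strings_diff_const[OF n i])
      then show ?thesis
        by (simp add: G_def F_def TS_def TB_def S_def AB tensor_copies_def e_def
            scaleR_conv_of_real[where 'a = complex])
    qed
    then show ?thesis by (simp add: vec_eq_iff)
  qed
  have psdKL: "psd (KL - G i)" if i: "i < n" for i
  proof -
    have "real n *\<^sub>R (KL - G i) = TS + (real n - 1) *\<^sub>R TB - real n *\<^sub>R G i"
      using n by (simp add: KL_def scaleR_right_diff_distrib scaleR_right_distrib)
    also have "\<dots> = (real n - 1) *\<^sub>R TB - (- 1) ^ CARD('l) *\<^sub>R (real n *\<^sub>R F i - TB)"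
      by (simp add: key[OF i])
    also have "psd \<dots>"
    \<comment> \<open>For even \<open>L\<close> the expression is \<open>n\<close> times
      \<open>TB - F i\<close>. For odd \<open>L\<close> it is \<open>n - 2\<close> times
      \<open>TB\<close> plus \<open>n\<close> times \<open>F i\<close>; the coefficient
      \<open>n - 2\<close> is negative only for \<open>n = 1\<close>, where \<open>TB = F i\<close>
      makes the whole expression zero.\<close>
    proof (cases "even (CARD('l))")
      case True
      then have "(real n - 1) *\<^sub>R TB - (- 1) ^ CARD('l) *\<^sub>R (real n *\<^sub>R F i - TB) = real n *\<^sub>R (TB - F i)"
        by (simp add: algebra_simps)
      then show ?thesis using psdTBF by (simp add: psd_scaleR)
    next
      case odd: False
      show ?thesis
      proof (cases "n = 1")
        case True
        then show ?thesis using TBF i by (simp add: psd_zero)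
      next
        case False
        from odd have "(real n - 1) *\<^sub>R TB - (- 1) ^ CARD('l) *\<^sub>R (real n *\<^sub>R F i - TB)
          = (real n - 1 - 1) *\<^sub>R TB + real n *\<^sub>R F i"
          unfolding scaleR_diff_left[of "real n - 1" 1 TB] by simp
        moreover have "real n \<ge> 2" using False n by simp
        moreover have "psd TB" using psd_add[OF psdTBF[of i] psdF[of i]] by simp
        ultimately show ?thesis using psdF by (simp add: psd_scaleR psd_add)
      qed
    qed
    finally have "psd ((1 / real n) *\<^sub>R (real n *\<^sub>R (KL - G i)))" by (rule psd_scaleR[rotated]) simp
    then show ?thesis using n by simp
  qed
  \<comment> \<open>Traces multiply over the copies, so \<open>TS\<close> has trace 1 and
    \<open>TB\<close> has trace \<open>(real n * q - 1) ^ CARD('l)\<close>.\<close>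
  have "trace KL = of_real (1 / real n + (real n - 1) / real n * (real n * q - 1) ^ CARD('l))"
    by (simp add: KL_def trace_add trace_scaleR TS_def TB_def trace_tensor_copies trS trB
        scaleR_conv_of_real[where 'a = complex])
  then have trKL: "Re (trace KL) = 1 / real n + (real n - 1) / real n * (real n * q - 1) ^ CARD('l)"
    by simp
  obtain N where N: "measurement n N" "q_G n (multi_prior TYPE('l) n \<eta>) (multi_state n \<eta> \<rho> \<sigma>)
      = pt_success n (multi_prior TYPE('l) n \<eta>) (multi_state n \<eta> \<rho> \<sigma>) N"
    using q_G_is_max(1)[OF n] by blast
  have G: "multi_prior TYPE('l) n \<eta> i *\<^sub>R partial_transpose (multi_state n \<eta> \<rho> \<sigma> i) = G i" for i
    unfolding G_def A_def
    by (rule multi_state_weighted) (use assms(1) in \<open>auto simp: ensemble_def\<close>)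
  have "pt_success n (multi_prior TYPE('l) n \<eta>) (multi_state n \<eta> \<rho> \<sigma>) N = (\<Sum>i<n. Re (trace (G i ** N i)))"
    by (simp add: pt_success_def scaleR_matrix_mult trace_scaleR flip: G)
  also have "\<dots> \<le> Re (trace KL)"
    by (rule measurement_value_le_trace[OF N(1) psdKL])
  finally show ?thesis using N(2) trKL by (simp add: q_def)
qed

end
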